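(* There exists a balanced group divisible triangle design $(V,\mathcal{G},\mathcal{B})$ of order $6$ with groups of dimension $2$ over $\mathbb{F}_2$, where $V=\mathbb{F}_{2^6}$ and $\mathcal{G}$ is the set of all $21$ one-dimensional $\mathbb{F}_{4}$-subspaces of $V$ (each a $2$-dimensional $\mathbb{F}_2$-subspace; i.e. the Desarguesian spread).
   Context: For a vector space $V$ over $\mathbb{F}_q$, a triangle is a set $\{\langle a,b\rangle,\langle b,c\rangle,\langle c,a\rangle\}$ of three $2$-dimensional subspaces, with $a,b,c$ linearly independent. For $m\mid n$, a group divisible triangle design of order $n$ with groups of dimension $m$ over $\mathbb{F}_q$ is a triple $(V,\mathcal{G},\mathcal{B})$: $V$ an $n$-dimensional $\mathbb{F}_q$-space, $\mathcal{G}$ a set of $m$-dimensional subspaces such that every nonzero vector lies in exactly one, and $\mathcal{B}$ a set of triangles such that every $2$-dimensional subspace either belongs to exactly one triangle of $\mathcal{B}$ and to no group, or to no triangle and to one group. A triangle covers a nonzero vector $x$ if $x$ lies in one of its three subspaces; the design is balanced if all nonzero vectors are covered by the same number of triangles of $\mathcal{B}$. *)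

theory Defs
  imports "HOL-Algebra.Algebraic_Closure_Type" "HOL-Library.Z2"
begin

definition covers :: "'v set set \<Rightarrow> 'v \<Rightarrow> bool" where
  "covers T x \<longleftrightarrow> (\<exists>L\<in>T. x \<in> L)"

definition balanced :: "'v :: zero set \<Rightarrow> 'v set set set \<Rightarrow> bool" where
  "balanced V \<B> \<longleftrightarrow> (\<exists>r. \<forall>x\<in>V. x \<noteq> 0 \<longrightarrow> card {T \<in> \<B>. covers T x} = r)"

locale fq_vector_space = vector_space scale
  for scale :: "'a :: field \<Rightarrow> 'b :: ab_group_add \<Rightarrow> 'b" +
  assumes finite_scalars: "finite (UNIV :: 'a set)"
begin

(* dim is not used here because it is 0 on every infinite-dimensional subspace *)
definition has_dim :: "'b set \<Rightarrow> nat \<Rightarrow> bool" where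
  "has_dim U k \<longleftrightarrow> (\<exists>B. finite B \<and> card B = k \<and> independent B \<and> span B = U)"

definition triangle :: "'b set \<Rightarrow> 'b set set \<Rightarrow> bool" where
  "triangle V T \<longleftrightarrow> (\<exists>a\<in>V. \<exists>b\<in>V. \<exists>c\<in>V. distinct [a, b, c] \<and> independent {a, b, c} \<and>
     T = {span {a, b}, span {b, c}, span {c, a}})"

(* V is a subspace of the ambient type 'b; the scalar field 'a plays the role of F_q.
   A 2-dimensional subspace L belongs to a group H when L is contained in H. *)
definition gd_triangle_design ::
  "nat \<Rightarrow> nat \<Rightarrow> 'b set \<Rightarrow> 'b set set \<Rightarrow> 'b set set set \<Rightarrow> bool" where
  "gd_triangle_design n m V \<G> \<B> \<longleftrightarrow>
     m dvd n \<and> has_dim V n \<and>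
     (\<forall>H\<in>\<G>. H \<subseteq> V \<and> has_dim H m) \<and>
     (\<forall>x\<in>V. x \<noteq> 0 \<longrightarrow> (\<exists>!H. H \<in> \<G> \<and> x \<in> H)) \<and>
     (\<forall>T\<in>\<B>. triangle V T) \<and>
     (\<forall>L. L \<subseteq> V \<and> has_dim L 2 \<longrightarrow>
        (\<exists>!T. T \<in> \<B> \<and> L \<in> T) \<and> \<not> (\<exists>H\<in>\<G>. L \<subseteq> H) \<or>
        \<not> (\<exists>T\<in>\<B>. L \<in> T) \<and> (\<exists>!H. H \<in> \<G> \<and> L \<subseteq> H))"

end

(* For q a power of 2, the roots of X^q - X form the subfield with q elements of
   the algebraic closure of F_2. *)
definition GF :: "nat \<Rightarrow> bit alg_closure set" where
  "GF q = {x. x ^ q = x}"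

lemma CHAR_bit [simp]: "CHAR(bit) = 2"
proof (rule CHAR_eqI)
  show "2 dvd n" if "of_nat n = (0 :: bit)" for n
    using even_of_nat[where 'a = bit, of n] that by simp
qed simp

lemma add_in_GF:
  assumes "x \<in> GF (2 ^ k)" "y \<in> GF (2 ^ k)"
  shows "x + y \<in> GF (2 ^ k)"
  using assms freshmans_dream'[where 'a = "bit alg_closure", of "2 ^ k" k x y]
  by (simp add: GF_def)

lemma uminus_bit_ac: "- x = (x :: bit alg_closure)"
proof -
  have "of_nat 2 = (0 :: bit alg_closure)"
    by (subst of_nat_eq_0_iff_char_dvd) simp
  hence "x + x = 0"
    by (metis mult_2 mult_zero_left of_nat_numeral)
  thus ?thesis
    by (simp add: neg_eq_iff_add_eq_0)
qed

lemma minus_bit_ac: "x - y = (x + y :: bit alg_closure)"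
  using diff_conv_add_uminus[of x y] by (simp only: uminus_bit_ac)

lemma card_GF:
  assumes "k > 0"
  shows "finite (GF (2 ^ k))" "card (GF (2 ^ k)) = 2 ^ k"
proof -
  define q :: nat where "q = 2 ^ k"
  have q: "q > 1" using one_less_power[of "2 :: nat" k] assms by (simp add: q_def)
  define p :: "bit alg_closure poly" where "p = monom 1 q + [:0, - 1:]"
  have deg: "degree p = q"
    unfolding p_def using q by (subst degree_add_eq_left) (auto simp: degree_monom_eq)
  hence [simp]: "p \<noteq> 0" using q by auto
  have "of_nat q = (0 :: bit alg_closure)"
    using assms by (subst of_nat_eq_0_iff_char_dvd) (simp add: q_def)
  hence pderiv: "pderiv p = - 1"
    by (simp add: p_def pderiv_add pderiv_monom pderiv_pCons one_pCons)
  have order_le: "order x p \<le> 1" for x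
  proof (rule ccontr)
    assume "\<not> order x p \<le> 1"
    hence "[:-x, 1:] ^ 2 dvd p"
      using le_imp_power_dvd[of 2 "order x p" "[:-x, 1:]"] order_1[of x p] dvd_trans by force
    then obtain s where "p = [:-x, 1:] * ([:-x, 1:] * s)"
      by (metis dvdE power2_eq_square mult.assoc)
    hence "poly (pderiv p) x = 0"
      by (simp only: pderiv_mult) simp
    thus False
      by (simp add: pderiv)
  qed
  have roots: "{x. poly p x = 0} = GF q"
    by (auto simp: p_def GF_def poly_monom)
  show "finite (GF (2 ^ k))"
    using poly_roots_finite[of p] roots by (simp add: q_def)
  obtain A where A: "size A = q" "p = smult (lead_coeff p) (\<Prod>x\<in>#A. [:-x, 1:])"
    using alg_closed_imp_factorization[of p] deg by auto
  have "proots p = proots (\<Prod>x\<in>#A. [:-x, 1:])"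
    by (subst A(2)) simp
  also have "\<dots> = A"
  proof (induction A)
    case (add x A)
    have "(\<Prod>x\<in>#A. [:-x, 1:]) \<noteq> 0"
      by (auto simp: prod_mset_zero_iff)
    thus ?case
      using add proots_mult[of "[:-x, 1:]" "\<Prod>x\<in>#A. [:-x, 1:]"]
      by (simp del: mult_pCons_left)
  qed simp
  finally have "size (proots p) = q"
    using A(1) by simp
  moreover have "proots p = mset_set (GF q)"
  proof (rule multiset_eqI)
    fix x
    show "count (proots p) x = count (mset_set (GF q)) x"
      using order_le[of x] order_root[of p x] poly_roots_finite[of p] roots
      by (cases "x \<in> GF q") auto
  qed
  ultimately show "card (GF (2 ^ k)) = 2 ^ k"
    by (simp add: q_def)
qed

lemma one_in_GF: "1 \<in> GF q"
  by (simp add: GF_def)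

typedef GF4 = "GF 4"
  by (rule exI[of _ 1]) (rule one_in_GF)

setup_lifting type_definition_GF4

instantiation GF4 :: field
begin

lift_definition zero_GF4 :: GF4 is 0 by (simp add: GF_def)
lift_definition one_GF4 :: GF4 is 1 by (simp add: GF_def)
lift_definition plus_GF4 :: "GF4 \<Rightarrow> GF4 \<Rightarrow> GF4" is "(+)"
  using add_in_GF[of _ 2] by simp
lift_definition uminus_GF4 :: "GF4 \<Rightarrow> GF4" is uminus
  by (simp only: uminus_bit_ac)
lift_definition minus_GF4 :: "GF4 \<Rightarrow> GF4 \<Rightarrow> GF4" is minus
  using add_in_GF[of _ 2] by (simp add: minus_bit_ac)
lift_definition times_GF4 :: "GF4 \<Rightarrow> GF4 \<Rightarrow> GF4" is "(*)"
  by (simp add: GF_def power_mult_distrib)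
lift_definition inverse_GF4 :: "GF4 \<Rightarrow> GF4" is inverse
  by (simp add: GF_def power_inverse)
lift_definition divide_GF4 :: "GF4 \<Rightarrow> GF4 \<Rightarrow> GF4" is "(/)"
  by (simp add: GF_def power_divide)

instance
  by standard (transfer; simp add: algebra_simps divide_inverse; fail)+

end

lemma finite_UNIV_bit: "finite (UNIV :: bit set)"
proof (rule finite_subset)
  show "(UNIV :: bit set) \<subseteq> {0, 1}"
    using bit_not_zero_iff by blast
qed simp

lemma finite_UNIV_GF4: "finite (UNIV :: GF4 set)"
  using card_GF(1)[of 2] finite_imageI[of "GF 4" Abs_GF4]
    type_definition.Abs_image[OF type_definition_GF4] by simp

global_interpretation F2: fq_vector_space "\<lambda>(c :: bit) x. to_ac c * x"
proof
  show "to_ac (c + d) * x = to_ac c * x + to_ac d * x" for c d :: bit and x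
    by (simp only: to_ac_add distrib_right)
  show "to_ac c * (to_ac d * x) = to_ac (c * d) * x" for c d :: bit and x
    by (simp only: to_ac_mult mult.assoc)
qed (simp_all add: distrib_left finite_UNIV_bit)

global_interpretation F4: fq_vector_space "\<lambda>(c :: GF4) x. Rep_GF4 c * x"
  by unfold_locales
    (simp_all add: algebra_simps plus_GF4.rep_eq times_GF4.rep_eq one_GF4.rep_eq finite_UNIV_GF4)

definition desarguesian_spread :: "bit alg_closure set set" where
  "desarguesian_spread = {U. U \<subseteq> GF 64 \<and> F4.has_dim U 1}"

end

(* Let \<omega> be a root of x^6 + x + 1. It generates the multiplicative group of GF(64), of order 63, and
   the nonzero points of the Desarguesian spread elements are the classes of exponents modulo 21.
   Multiplication by \<omega>^3 has order 21 and acts regularly on each of the 30 orbits of planes outside the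
   spread. The design is the union of the 21 translates of 10 triangles (found by computer search)
   whose 30 sides represent these orbits. A plane through \<omega>^u and \<omega>^v has its orbit determined by
   u mod 3 and v - u mod 63, so the design property says that the 180 ordered pairs of points on
   the 30 sides yield each admissible value of (u mod 3, v - u mod 63) exactly once. The design is
   balanced because the base triangles cover 20 points of each residue class of exponents mod 3. *)
theory Submission
  imports Defs
begin

section \<open>Subspaces over finite fields\<close>

context fq_vector_space
begin

text \<open>As b lies outside the span of B, the map (k, x) to k b + x is injective, so each new
  basis vector multiplies the size by the number of scalars.\<close>

lemma card_span:
  assumes "finite B" "independent B"
  shows "finite (span B) \<and> card (span B) = card (UNIV :: 'a set) ^ card B"
  using assms
proof (induction B rule: finite_induct)
  case (insert b B)
  have b: "b \<notin> span B" and indep: "independent B"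
    using insert by (auto simp: independent_insert)
  have IH: "finite (span B)" "card (span B) = card (UNIV :: 'a set) ^ card B"
    using insert.IH[OF indep] by auto
  define f where "f = (\<lambda>(k, x). scale k b + x)"
  have "inj_on f (UNIV \<times> span B)"
  proof (rule inj_onI, clarsimp simp: f_def)
    fix k k' x x' assume x: "x \<in> span B" "x' \<in> span B" and eq: "scale k b + x = scale k' b + x'"
    have "scale (k - k') b = x' - x"
      using eq by (simp add: algebra_simps)
    hence "scale (k - k') b \<in> span B"
      using x span_diff by simp
    hence "k = k'"
      using b span_scale[of "scale (k - k') b" B "inverse (k - k')"]
      by (cases "k - k' = 0") simp_all
    thus "k = k' \<and> x = x'"
      using eq by simp
  qed
  moreover have "f ` (UNIV \<times> span B) = span (insert b B)"
  proof (intro equalityI subsetI)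
    fix y assume "y \<in> f ` (UNIV \<times> span B)"
    then obtain k x where "x \<in> span B" "y = scale k b + x"
      by (auto simp: f_def)
    thus "y \<in> span (insert b B)"
      unfolding span_breakdown_eq by (intro exI[of _ k]) simp
  next
    fix y assume "y \<in> span (insert b B)"
    then obtain k where "y - scale k b \<in> span B"
      by (auto simp: span_breakdown_eq)
    thus "y \<in> f ` (UNIV \<times> span B)"
      by (intro image_eqI[of _ _ "(k, y - scale k b)"]) (auto simp: f_def)
  qed
  ultimately have "bij_betw f (UNIV \<times> span B) (span (insert b B))"
    by (simp add: bij_betw_def)
  thus ?case
    using IH insert.hyps finite_scalars bij_betw_finite[of f] bij_betw_same_card[of f]
    by (fastforce simp: card_cartesian_product)
qed simp

text \<open>Turns dimension arguments into counting; it serves the \<open>GF(2)\<close>-structure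
  and the \<open>GF(4)\<close>-structure on the same vectors alike.\<close>

lemma has_dim_iff_card:
  "has_dim U k \<longleftrightarrow> subspace U \<and> finite U \<and> card U = card (UNIV :: 'a set) ^ k"
proof
  show "subspace U \<and> finite U \<and> card U = card (UNIV :: 'a set) ^ k" if "has_dim U k"
    using that card_span by (auto simp: has_dim_def)
next
  assume U: "subspace U \<and> finite U \<and> card U = card (UNIV :: 'a set) ^ k"
  obtain B where B: "B \<subseteq> U" "independent B" "U \<subseteq> span B"
    using maximal_independent_subset by blast
  have span: "span B = U"
    using B U by (metis span_minimal subset_antisym)
  have "finite B"
    using B U finite_subset by blast
  \<comment> \<open>With at least two scalars, a power of their number determines its
    exponent.\<close>
  moreover have "card (UNIV :: 'a set) > 1"
    using finite_scalars card_mono[of UNIV "{0, 1 :: 'a}"] by simp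
  ultimately have "card B = k"
    using card_span[of B] B U span by simp
  thus "has_dim U k"
    using \<open>finite B\<close> B span by (auto simp: has_dim_def)
qed

end

section \<open>The field with 64 elements\<close>

lemma add_self_ac [simp]: "x + x = (0 :: bit alg_closure)"
  using minus_bit_ac[of x x] by simp

lemma of_bool_xor_ac: "of_bool (a \<noteq> b) = (of_bool a + of_bool b :: bit alg_closure)"
  by (cases a; cases b) simp_all

text \<open>Coordinates with respect to the powers \<open>1, \<omega>, \<dots>, \<omega>\<^sup>5\<close> of a root of \<open>x\<^sup>6 + x + 1\<close>;
  \<open>vshift\<close> is multiplication by \<open>\<omega>\<close>.\<close>

type_synonym vec = "bool \<times> bool \<times> bool \<times> bool \<times> bool \<times> bool"

fun vadd :: "vec \<Rightarrow> vec \<Rightarrow> vec" where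
  "vadd (a, b, c, d, e, f) (a', b', c', d', e', f') =
     (a \<noteq> a', b \<noteq> b', c \<noteq> c', d \<noteq> d', e \<noteq> e', f \<noteq> f')"

fun vshift :: "vec \<Rightarrow> vec" where
  "vshift (a, b, c, d, e, f) = (f, a \<noteq> f, b, c, d, e)"

definition vzero :: vec where "vzero = (False, False, False, False, False, False)"
definition vone :: vec where "vone = (True, False, False, False, False, False)"

text \<open>Each entry is obtained from the previous one by a single shift, which keeps the
  evaluation of 63 powers cheap.\<close>

fun iterates :: "nat \<Rightarrow> vec \<Rightarrow> vec list" where
  "iterates 0 v = []"
| "iterates (Suc n) v = v # iterates n (vshift v)"

text \<open>Any root will do: one exists by algebraic closedness, and its order 63 is computed from
  the equation.\<close>

definition \<omega> :: "bit alg_closure" where "\<omega> = (SOME x. x ^ 6 = x + 1)"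

lemma omega_power6: "\<omega> ^ 6 = \<omega> + 1"
proof -
  obtain x :: "bit alg_closure" where "poly [:1, 1, 0, 0, 0, 0, 1:] x = 0"
    using alg_closed_imp_poly_has_root[of "[:1, 1, 0, 0, 0, 0, 1 :: bit alg_closure:]"] by auto
  hence "(x + 1) + x ^ 6 = 0"
    by (simp add: eval_nat_numeral algebra_simps)
  hence "x ^ 6 = x + 1"
    by (metis add_self_ac add_left_cancel)
  thus ?thesis
    unfolding \<omega>_def by (rule someI)
qed

lemma omega_nonzero [simp]: "\<omega> \<noteq> 0"
  using omega_power6 by (auto simp: power_0_left)

fun ev :: "vec \<Rightarrow> bit alg_closure" where
  "ev (a, b, c, d, e, f) = of_bool a + of_bool b * \<omega> + of_bool c * \<omega> ^ 2 +
     of_bool d * \<omega> ^ 3 + of_bool e * \<omega> ^ 4 + of_bool f * \<omega> ^ 5"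

lemma ev_vzero [simp]: "ev vzero = 0" and ev_vone [simp]: "ev vone = 1"
  by (simp_all add: vzero_def vone_def)

lemma ev_vadd: "ev (vadd u v) = ev u + ev v"
  by (cases u; cases v) (simp only: vadd.simps ev.simps of_bool_xor_ac algebra_simps)

lemma ev_vshift: "ev (vshift v) = \<omega> * ev v"
proof (cases v)
  case (fields a b c d e f)
  have "\<omega> * ev v = of_bool a * \<omega> + of_bool b * \<omega> ^ 2 + of_bool c * \<omega> ^ 3 +
      of_bool d * \<omega> ^ 4 + of_bool e * \<omega> ^ 5 + of_bool f * \<omega> ^ 6"
    by (simp add: fields distrib_left eval_nat_numeral ac_simps)
  thus ?thesis
    by (simp only: fields vshift.simps ev.simps of_bool_xor_ac omega_power6 algebra_simps
        mult_1_left mult_1_right)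
qed

lemma ev_vshift_funpow: "ev ((vshift ^^ n) vone) = \<omega> ^ n"
  by (induction n) (simp_all add: ev_vshift)

lemma vshift_period: "(vshift ^^ 63) vone = vone"
  by code_simp

lemma omega_power63: "\<omega> ^ 63 = 1"
  using ev_vshift_funpow[of 63] by (simp only: vshift_period ev_vone)

text \<open>Since the iterates exhaust the nonzero vectors, the equation \<open>\<omega>\<^sup>6 = \<omega> + 1\<close> alone forces
  \<open>1, \<dots>, \<omega>\<^sup>5\<close> to be independent (\<open>ev_eq_0_iff\<close>).\<close>

lemma distinct_iterates: "distinct (vzero # iterates 63 vone)"
  by code_simp

lemma length_iterates [simp]: "length (iterates n v) = n"
  by (induction n arbitrary: v) simp_all

lemma nth_iterates: "k < n \<Longrightarrow> iterates n v ! k = (vshift ^^ k) v"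
proof (induction n arbitrary: k v)
  case (Suc n)
  thus ?case by (cases k) (simp_all add: funpow_swap1)
qed simp

text \<open>The list has 64 distinct entries, and there are only 2^6 vectors.\<close>

lemma set_iterates_UNIV: "set (vzero # iterates 63 vone) = UNIV"
proof (rule card_subset_eq)
  show "card (set (vzero # iterates 63 vone)) = card (UNIV :: vec set)"
    unfolding distinct_card[OF distinct_iterates]
    by (simp add: card_cartesian_product flip: UNIV_Times_UNIV)
qed simp_all

lemma vec_cases:
  obtains "v = vzero" | k where "k < 63" "v = (vshift ^^ k) vone"
proof -
  have "v \<in> set (vzero # iterates 63 vone)"
    unfolding set_iterates_UNIV ..
  thus ?thesis
    using that by (auto simp: in_set_conv_nth nth_iterates)
qed

lemma ev_eq_0_iff: "ev v = 0 \<longleftrightarrow> v = vzero"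
proof
  assume "ev v = 0"
  thus "v = vzero"
    by (cases v rule: vec_cases) (simp_all add: ev_vshift_funpow)
qed simp

lemma inj_ev: "inj ev"
proof
  fix u v assume "ev u = ev v"
  hence "vadd u v = vzero"
    by (simp add: ev_vadd flip: ev_eq_0_iff)
  thus "u = v"
    by (cases u; cases v) (simp add: vzero_def)
qed

lemma omega_power_inj: "\<omega> ^ i = \<omega> ^ j \<Longrightarrow> i < 63 \<Longrightarrow> j < 63 \<Longrightarrow> i = j"
proof -
  assume *: "\<omega> ^ i = \<omega> ^ j" "i < 63" "j < 63"
  have "(vshift ^^ i) vone = (vshift ^^ j) vone"
    using * by (intro injD[OF inj_ev]) (simp add: ev_vshift_funpow)
  hence "iterates 63 vone ! i = iterates 63 vone ! j"
    using * by (simp add: nth_iterates)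
  thus ?thesis
    using * distinct_iterates by (simp add: nth_eq_iff_index_eq)
qed

text \<open>Integer exponents admit differences and negative shifts; they matter only modulo 63
  (\<open>pw_eq_iff\<close>).\<close>

definition pw :: "int \<Rightarrow> bit alg_closure" where "pw i = \<omega> powi i"

lemma pw_nonzero [simp]: "pw i \<noteq> 0" "0 \<noteq> pw i"
  by (simp_all add: pw_def)

lemma pw_0 [simp]: "pw 0 = 1"
  by (simp add: pw_def)

lemma pw_add: "pw (i + j) = pw i * pw j"
  by (simp add: pw_def power_int_add)

lemma pw_power: "pw i ^ n = pw (int n * i)"
  by (induction n) (simp_all add: pw_add distrib_right)

lemma pw_nat: "0 \<le> i \<Longrightarrow> pw i = \<omega> ^ nat i"
  by (simp add: pw_def power_int_def)

lemma pw_mod: "pw (i mod 63) = pw i"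
proof -
  have "pw 63 = 1"
    by (simp add: pw_nat omega_power63)
  hence "pw (63 * k) = 1" for k
    by (simp add: pw_def power_int_mult)
  thus ?thesis
    using pw_add[of "63 * (i div 63)" "i mod 63"] by simp
qed

lemma pw_eq_iff: "pw i = pw j \<longleftrightarrow> i mod 63 = j mod 63"
proof
  assume "pw i = pw j"
  hence "\<omega> ^ nat (i mod 63) = \<omega> ^ nat (j mod 63)"
    by (metis pw_mod pw_nat pos_mod_sign zero_less_numeral)
  hence "nat (i mod 63) = nat (j mod 63)"
    by (rule omega_power_inj) (simp_all add: nat_less_iff)
  thus "i mod 63 = j mod 63"
    by simp
qed (metis pw_mod)

text \<open>Both sets have 64 elements, so one inclusion is enough, and it follows from \<omega>^63
  = 1.\<close>

lemma GF64_eq: "GF 64 = range ev"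
proof (rule card_subset_eq[symmetric])
  show "finite (GF 64)" "card (range ev) = card (GF 64)"
    using card_GF[of 6] card_image[OF inj_ev]
    by (simp_all add: card_cartesian_product flip: UNIV_Times_UNIV)
  have "ev v ^ 64 = ev v" for v
  proof (cases v rule: vec_cases)
    case (2 k)
    have "(\<omega> ^ k) ^ 64 = (\<omega> ^ 63) ^ k * \<omega> ^ k"
      by (simp add: mult.commute flip: power_mult power_add)
    thus ?thesis
      by (simp add: 2 ev_vshift_funpow omega_power63)
  qed simp
  thus "range ev \<subseteq> GF 64"
    by (auto simp: GF_def)
qed

lemma pw_in_GF64 [simp]: "pw i \<in> GF 64"
proof -
  have "pw i = ev ((vshift ^^ nat (i mod 63)) vone)"
    by (simp add: ev_vshift_funpow pw_mod flip: pw_nat)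
  thus ?thesis
    by (simp add: GF64_eq)
qed

lemma GF64_cases:
  assumes "x \<in> GF 64" "x \<noteq> 0"
  obtains i where "0 \<le> i" "i < 63" "x = pw i"
proof -
  obtain v where "x = ev v"
    using assms by (auto simp: GF64_eq)
  thus ?thesis
    using assms that[of "int k" for k]
    by (cases v rule: vec_cases) (auto simp: ev_vshift_funpow pw_nat)
qed

section \<open>Planes over \<open>GF(2)\<close> and the Desarguesian spread\<close>

lemma F2_has_dim_iff: "F2.has_dim U k \<longleftrightarrow> F2.subspace U \<and> finite U \<and> card U = 2 ^ k"
proof -
  have "(UNIV :: bit set) = {0, 1}"
    using bit_not_zero_iff by auto
  hence "card (UNIV :: bit set) = 2"
    by (metis card_2_iff zero_neq_one)
  thus ?thesis
    by (simp add: F2.has_dim_iff_card)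
qed

text \<open>The only scalars are 0 and 1, so closure under scaling reduces to containing 0.\<close>

lemma F2_subspace_iff:
  "F2.subspace S \<longleftrightarrow> 0 \<in> S \<and> (\<forall>x\<in>S. \<forall>y\<in>S. x + y \<in> S)"
proof -
  have "to_ac c * x \<in> S" if "0 \<in> S" "x \<in> S" for c :: bit and x S
    using that bit_not_zero_iff[of c] by (cases "c = 0") auto
  thus ?thesis
    by (auto simp: F2.subspace_def)
qed

definition plane :: "bit alg_closure \<Rightarrow> bit alg_closure \<Rightarrow> bit alg_closure set" where
  "plane x y = {0, x, y, x + y}"

lemma add_left_cancel_ac [simp]: "x + (x + y) = (y :: bit alg_closure)"
  by (simp flip: add.assoc)

lemma subspace_plane: "F2.subspace (plane x y)"
  unfolding F2_subspace_iff by (auto simp: plane_def ac_simps)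

lemma span_eq_plane: "F2.span {x, y} = plane x y"
  by (rule F2.span_unique) (auto simp: subspace_plane, auto simp: plane_def F2_subspace_iff)

lemma add_eq_0_iff_ac: "x + y = 0 \<longleftrightarrow> x = (y :: bit alg_closure)"
  using minus_bit_ac[of x y] by (metis right_minus_eq)

lemma card_plane:
  assumes "x \<noteq> 0" "y \<noteq> 0" "x \<noteq> y"
  shows "card (plane x y) = 4"
proof -
  have "x + y \<noteq> 0"
    using assms by (simp add: add_eq_0_iff_ac)
  thus ?thesis
    using assms by (simp add: plane_def)
qed

lemma has_dim_plane: "x \<noteq> 0 \<Longrightarrow> y \<noteq> 0 \<Longrightarrow> x \<noteq> y \<Longrightarrow> F2.has_dim (plane x y) 2"
  by (simp add: F2_has_dim_iff subspace_plane card_plane) (simp add: plane_def)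

text \<open>The plane is contained in L and both have four elements.\<close>

lemma has_dim_2_eq_plane:
  assumes "F2.has_dim L 2" "x \<in> L" "y \<in> L" "x \<noteq> 0" "y \<noteq> 0" "x \<noteq> y"
  shows "L = plane x y"
proof (rule card_subset_eq[symmetric])
  show "finite L" "card (plane x y) = card L"
    using assms by (auto simp: F2_has_dim_iff card_plane)
  show "plane x y \<subseteq> L"
    using assms by (auto simp: F2_has_dim_iff F2_subspace_iff plane_def)
qed

lemma has_dim_2_obtain:
  assumes "F2.has_dim L 2"
  obtains x y where "x \<in> L" "y \<in> L" "x \<noteq> 0" "y \<noteq> 0" "x \<noteq> y" "L = plane x y"
proof -
  have "\<not> L \<subseteq> {0}"
    using assms card_mono[of "{0}" L] by (auto simp: F2_has_dim_iff)
  then obtain x where x: "x \<in> L" "x \<noteq> 0"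
    by auto
  have "\<not> L \<subseteq> {0, x}"
    using assms x card_mono[of "{0, x}" L] by (auto simp: F2_has_dim_iff)
  then obtain y where "y \<in> L" "y \<noteq> 0" "y \<noteq> x"
    by auto
  thus ?thesis
    using x that has_dim_2_eq_plane[OF assms] by metis
qed

lemma independent_3:
  assumes "x \<noteq> 0" "y \<noteq> 0" "x \<noteq> y" "z \<notin> plane x y"
  shows "F2.independent {x, y, z}"
proof -
  \<comment> \<open>\<open>plane y y\<close> degenerates to {0, y}, so \<open>span_eq_plane\<close>
    also describes the span of one vector.\<close>
  have "x \<notin> F2.span {y}"
    using assms span_eq_plane[of y y] by (simp add: plane_def)
  hence "F2.independent {x, y}"
    using assms by (auto simp: F2.independent_insert)
  hence "F2.independent (insert z {x, y})"
    using assms by (simp add: F2.independent_insert span_eq_plane)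
  thus ?thesis
    by (simp add: insert_commute)
qed

section \<open>Lines over \<open>GF(4)\<close> and their exponents\<close>

definition GF4_line :: "bit alg_closure \<Rightarrow> bit alg_closure set" where
  "GF4_line x = (\<lambda>c. c * x) ` GF 4"

lemma range_Rep_GF4: "range Rep_GF4 = GF 4"
  by (rule type_definition.Rep_range[OF type_definition_GF4])

lemma card_GF4: "finite (GF 4)" "card (GF 4) = 4"
  using card_GF[of 2] by simp_all

lemma F4_has_dim_1_iff: "F4.has_dim U 1 \<longleftrightarrow> F4.subspace U \<and> finite U \<and> card U = 4"
proof -
  have "card (UNIV :: GF4 set) = 4"
    using card_image[of Rep_GF4 UNIV] Rep_GF4_inject card_GF4
    by (simp add: range_Rep_GF4 inj_def)
  thus ?thesis
    by (simp add: F4.has_dim_iff_card)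
qed

lemma F4_subspace_iff:
  "F4.subspace S \<longleftrightarrow>
     0 \<in> S \<and> (\<forall>x\<in>S. \<forall>y\<in>S. x + y \<in> S) \<and> (\<forall>c\<in>GF 4. \<forall>x\<in>S. c * x \<in> S)"
  unfolding F4.subspace_def by (auto simp flip: range_Rep_GF4)

lemma GF_mult: "x \<in> GF q \<Longrightarrow> y \<in> GF q \<Longrightarrow> x * y \<in> GF q"
  by (simp add: GF_def power_mult_distrib)

lemma zero_in_GF: "q > 0 \<Longrightarrow> 0 \<in> GF q"
  by (simp add: GF_def)

text \<open>Since 64 = 4^3, the equation x^4 = x is applied three times.\<close>

lemma GF4_subset_GF64: "GF 4 \<subseteq> GF 64"
proof
  fix x assume "x \<in> GF 4"
  hence "((x ^ 4) ^ 4) ^ 4 = x"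
    by (simp add: GF_def)
  thus "x \<in> GF 64"
    by (simp add: GF_def flip: power_mult)
qed

lemma GF4_line_refl: "x \<in> GF4_line x"
  using one_in_GF[of 4] by (force simp: GF4_line_def)

lemma subspace_GF4_line: "F4.subspace (GF4_line x)"
  unfolding F4_subspace_iff
proof (intro conjI ballI)
  show "0 \<in> GF4_line x"
    using zero_in_GF[of 4] by (force simp: GF4_line_def)
  show "y + z \<in> GF4_line x" if "y \<in> GF4_line x" "z \<in> GF4_line x" for y z
    using that add_in_GF[of _ 2] unfolding GF4_line_def
    by (auto simp flip: distrib_right)
  show "c * y \<in> GF4_line x" if "c \<in> GF 4" "y \<in> GF4_line x" for c y
    using that GF_mult[of c 4] unfolding GF4_line_def
    by (auto simp flip: mult.assoc)
qed

lemma card_GF4_line: "x \<noteq> 0 \<Longrightarrow> card (GF4_line x) = 4" and finite_GF4_line: "finite (GF4_line x)"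
  unfolding GF4_line_def by (auto simp: card_GF4 inj_on_def card_image)

lemma spread_iff:
  "H \<in> desarguesian_spread \<longleftrightarrow> H \<subseteq> GF 64 \<and> F4.subspace H \<and> finite H \<and> card H = 4"
  by (simp only: desarguesian_spread_def mem_Collect_eq F4_has_dim_1_iff)

lemma GF4_line_in_spread:
  assumes "x \<in> GF 64" "x \<noteq> 0"
  shows "GF4_line x \<in> desarguesian_spread"
proof -
  have "GF4_line x \<subseteq> GF 64"
    using assms GF4_subset_GF64 GF_mult[of _ 64 x] by (auto simp: GF4_line_def)
  thus ?thesis
    using assms by (simp add: spread_iff subspace_GF4_line card_GF4_line finite_GF4_line)
qed

text \<open>H contains all \<open>GF(4)\<close>-multiples of x, and there are already four of them.
  Hence a nonzero vector lies in at most one group.\<close>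

lemma spread_eq_GF4_line:
  assumes "H \<in> desarguesian_spread" "x \<in> H" "x \<noteq> 0"
  shows "H = GF4_line x"
proof (rule card_subset_eq[symmetric])
  have H: "F4.subspace H" "finite H" "card H = 4"
    using assms by (simp_all add: spread_iff)
  show "finite H" "card (GF4_line x) = card H"
    using H assms by (simp_all add: card_GF4_line)
  show "GF4_line x \<subseteq> H"
    using H assms by (auto simp: GF4_line_def F4_subspace_iff)
qed

lemma spread_has_dim_2: "H \<in> desarguesian_spread \<Longrightarrow> F2.has_dim H 2"
  by (simp add: spread_iff F2_has_dim_iff F2_subspace_iff F4_subspace_iff)

text \<open>Expresses that multiplication by \<omega>^3 has order 21 and that its powers move every
  nonzero point regularly.\<close>

lemma mod63_triple: "(u + 3 * s) mod 63 = (u + 3 * s') mod 63 \<longleftrightarrow> s mod 21 = (s' :: int) mod 21"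
proof -
  have "(u + 3 * s) mod 63 = (u + 3 * s') mod 63 \<longleftrightarrow> 3 * 21 dvd 3 * (s - s')"
    by (simp add: mod_eq_dvd_iff algebra_simps)
  thus ?thesis
    by (simp only: dvd_mult_cancel_left) (simp add: mod_eq_dvd_iff)
qed

text \<open>With d = j - i, the quotient \<omega>^d lies in \<open>GF 4\<close> iff \<omega>^(4d) =
  \<omega>^d, that is, iff 63 divides 3d.\<close>

lemma pw_in_GF4_line_iff: "pw j \<in> GF4_line (pw i) \<longleftrightarrow> j mod 21 = i mod 21"
proof -
  have "pw j \<in> GF4_line (pw i) \<longleftrightarrow> pw (j - i) \<in> GF 4"
  proof
    assume "pw j \<in> GF4_line (pw i)"
    then obtain c where "c \<in> GF 4" "pw j = c * pw i"
      by (auto simp: GF4_line_def)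
    moreover have "pw j = pw (j - i) * pw i"
      by (simp flip: pw_add)
    ultimately show "pw (j - i) \<in> GF 4"
      by simp
  next
    assume "pw (j - i) \<in> GF 4"
    thus "pw j \<in> GF4_line (pw i)"
      unfolding GF4_line_def by (rule rev_image_eqI) (simp flip: pw_add)
  qed
  also have "\<dots> \<longleftrightarrow> (4 * (j - i)) mod 63 = (j - i) mod 63"
    by (simp add: GF_def pw_power pw_eq_iff)
  also have "\<dots> \<longleftrightarrow> j mod 21 = i mod 21"
    using mod63_triple[of "j - i" "j - i" 0] by (simp add: mod_eq_dvd_iff mod_eq_0_iff_dvd)
  finally show ?thesis .
qed

lemma spread_pw_iff:
  "H \<in> desarguesian_spread \<Longrightarrow> pw i \<in> H \<Longrightarrow> pw j \<in> H \<longleftrightarrow> j mod 21 = i mod 21"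
  using spread_eq_GF4_line[of H "pw i"] by (simp add: pw_in_GF4_line_iff)

lemma card_spread: "card desarguesian_spread = 21"
proof -
  have "desarguesian_spread = (\<lambda>i. GF4_line (pw i)) ` {0..<21}"
  proof (intro equalityI subsetI)
    fix H assume H: "H \<in> desarguesian_spread"
    then obtain x where "x \<in> H" "x \<noteq> 0"
      using has_dim_2_obtain[OF spread_has_dim_2] by metis
    moreover from this H obtain i where "x = pw i"
      using GF64_cases[of x] by (auto simp: spread_iff)
    ultimately have "pw (i mod 21) \<in> H"
      using H spread_pw_iff[of H i "i mod 21"] by simp
    hence "H = GF4_line (pw (i mod 21))"
      using H by (intro spread_eq_GF4_line) simp_all
    thus "H \<in> (\<lambda>i. GF4_line (pw i)) ` {0..<21}"
      by (rule image_eqI) simp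
  qed (auto intro: GF4_line_in_spread)
  moreover have "inj_on (\<lambda>i. GF4_line (pw i)) {0..<21}"
  proof (rule inj_onI)
    fix i j :: int assume "i \<in> {0..<21}" "j \<in> {0..<21}" "GF4_line (pw i) = GF4_line (pw j)"
    thus "i = j"
      using GF4_line_refl[of "pw i"] by (simp add: pw_in_GF4_line_iff)
  qed
  ultimately show ?thesis
    using card_image by fastforce
qed

section \<open>The design\<close>

text \<open>A base triangle is given by the exponents \<open>a, b, c\<close> of its vertices, followed by the exponents
  of the third points of its sides \<open>ab\<close>, \<open>bc\<close>, \<open>ca\<close>.\<close>

type_synonym tri = "int \<times> int \<times> int \<times> int \<times> int \<times> int"
definition base :: "tri list" where
  "base =
    [(0, 1, 9, 6, 49, 45), (0, 2, 4, 12, 14, 24), (0, 3, 16, 32, 38, 33), (0, 5, 8, 62, 37, 48),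
     (0, 7, 20, 26, 42, 59), (0, 10, 17, 61, 36, 47), (0, 11, 19, 25, 59, 56),
     (0, 14, 50, 52, 5, 22), (1, 17, 28, 34, 42, 19), (1, 2, 61, 7, 22, 30)]"

fun edges :: "tri \<Rightarrow> (int \<times> int \<times> int) list" where
  "edges (a, b, c, p, q, r) = [(a, b, p), (b, c, q), (c, a, r)]"

fun points :: "tri \<Rightarrow> int list" where
  "points (a, b, c, p, q, r) = [a, b, c, p, q, r]"

fun pairs :: "int \<times> int \<times> int \<Rightarrow> (int \<times> int) list" where
  "pairs (u, v, p) = [(u, v), (v, u), (u, p), (p, u), (v, p), (p, v)]"

text \<open>Each ordered pair carries its base triangle, so that distinct keys also tell the
  triangles apart.\<close>

definition flags :: "(tri \<times> int \<times> int) list" where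
  "flags = concat (map (\<lambda>t. map (Pair t) (concat (map pairs (edges t)))) base)"

text \<open>The key encodes the orbit of the ordered pair \<open>(\<omega>\<^sup>u, \<omega>\<^sup>v)\<close> under multiplication by \<open>\<omega>\<^sup>3\<close>. As 21
  divides 63, it is a multiple of 21 exactly if both points lie in the same spread element.\<close>

definition key :: "tri \<times> int \<times> int \<Rightarrow> int" where
  "key = (\<lambda>(t, u, v). 63 * (u mod 3) + (v - u) mod 63)"

text \<open>The computational core. Of the 3 * 63 = 189 possible keys, 9 are multiples of 21;
  equality with the list of the other 180 shows at once that no key repeats and none is
  missing.\<close>

lemma sort_keys: "sort (map key flags) = filter (\<lambda>k. k mod 21 \<noteq> 0) [0..188]"
  by code_simp

text \<open>Certifies in coordinates that the tabulated third point of each side is the sum of the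
  other two.\<close>

lemma base_edges:
  "\<forall>t\<in>set base. \<forall>(u, v, p)\<in>set (edges t).
     vadd ((vshift ^^ nat u) vone) ((vshift ^^ nat v) vone) = (vshift ^^ nat p) vone"
  by code_simp

lemma base_points:
  "\<forall>t\<in>set base. distinct (points t) \<and> (\<forall>p\<in>set (points t). 0 \<le> p \<and> p < 63)"
  by code_simp

lemma distinct_base: "distinct base"
  by code_simp

lemma count_points:
  "\<forall>r\<in>set [0..2]. (\<Sum>t\<leftarrow>base. length (filter (\<lambda>p. p mod 3 = r) (points t))) = 20"
  by code_simp

definition side :: "int \<Rightarrow> int \<times> int \<times> int \<Rightarrow> bit alg_closure set" where
  "side s = (\<lambda>(u, v, p). plane (pw (u + 3 * s)) (pw (v + 3 * s)))"

definition block :: "tri \<Rightarrow> int \<Rightarrow> bit alg_closure set set" where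
  "block t s = side s ` set (edges t)"

text \<open>Shifts range over all integers, but a block depends only on the shift modulo 21
  (\<open>block_cong\<close>), so each base triangle yields 21 blocks.\<close>

definition blocks :: "bit alg_closure set set set" where
  "blocks = (\<Union>t\<in>set base. range (block t))"

lemma edge_points:
  assumes "t \<in> set base" "(u, v, p) \<in> set (edges t)"
  shows "u \<noteq> v" "u \<noteq> p" "v \<noteq> p" "{u, v, p} \<subseteq> {0..<63}"
  using base_points[rule_format, OF assms(1)] assms(2) by (cases t; auto)+

lemma edge_sum:
  assumes "t \<in> set base" "(u, v, p) \<in> set (edges t)"
  shows "pw (u + i) + pw (v + i) = pw (p + i)"
proof -
  have "vadd ((vshift ^^ nat u) vone) ((vshift ^^ nat v) vone) = (vshift ^^ nat p) vone"
    using base_edges assms by fast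
  from arg_cong[OF this, of ev] have "pw u + pw v = pw p"
    using edge_points[OF assms] by (simp add: ev_vadd ev_vshift_funpow pw_nat)
  thus ?thesis
    by (simp add: pw_add flip: distrib_right)
qed

lemma pw_shift_eq_iff:
  "u \<in> {0..<63} \<Longrightarrow> v \<in> {0..<63} \<Longrightarrow> pw (u + i) = pw (v + i) \<longleftrightarrow> u = v"
  by (simp add: pw_add) (simp add: pw_eq_iff)

lemma edge_distinct:
  assumes "t \<in> set base" "(u, v, p) \<in> set (edges t)"
  shows "pw (u + i) \<noteq> pw (v + i)" "pw (u + i) \<noteq> pw (p + i)" "pw (v + i) \<noteq> pw (p + i)"
  using edge_points[OF assms] by (simp_all add: pw_shift_eq_iff)

lemma side_eq:
  assumes "t \<in> set base" "(u, v, p) \<in> set (edges t)"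
  shows "side s (u, v, p) = {0, pw (u + 3 * s), pw (v + 3 * s), pw (p + 3 * s)}"
  by (simp add: side_def plane_def edge_sum[OF assms])

lemma side_has_dim_2: "t \<in> set base \<Longrightarrow> l \<in> set (edges t) \<Longrightarrow> F2.has_dim (side s l) 2"
  by (cases l) (auto simp: side_def edge_distinct intro!: has_dim_plane)

lemma set_flags:
  "set flags = {(t, u, v). t \<in> set base \<and> (\<exists>l\<in>set (edges t). (u, v) \<in> set (pairs l))}"
  by (auto simp: flags_def image_iff)

lemma side_flag:
  assumes "t \<in> set base" "l \<in> set (edges t)" "x \<in> side s l" "y \<in> side s l"
    "x \<noteq> 0" "y \<noteq> 0" "x \<noteq> y"
  obtains u v where "(u, v) \<in> set (pairs l)" "x = pw (u + 3 * s)" "y = pw (v + 3 * s)"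
proof (cases l)
  case (fields u v p)
  thus ?thesis
    using assms side_eq[of t u v p s] that by auto
qed

lemma flag_side:
  assumes "t \<in> set base" "l \<in> set (edges t)" "(u, v) \<in> set (pairs l)"
  shows "pw (u + 3 * s) \<in> side s l" "pw (v + 3 * s) \<in> side s l" "pw (u + 3 * s) \<noteq> pw (v + 3 * s)"
    "side s l = plane (pw (u + 3 * s)) (pw (v + 3 * s))"
proof -
  obtain a b c where l: "l = (a, b, c)"
    by (cases l)
  show *: "pw (u + 3 * s) \<in> side s l" "pw (v + 3 * s) \<in> side s l"
    "pw (u + 3 * s) \<noteq> pw (v + 3 * s)"
    using assms side_eq[of t a b c s] edge_distinct[of t a b c "3 * s"] unfolding l by auto
  show "side s l = plane (pw (u + 3 * s)) (pw (v + 3 * s))"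
    using * by (intro has_dim_2_eq_plane side_has_dim_2[OF assms(1,2)]) simp_all
qed

section \<open>Keys and orbits of ordered pairs\<close>

lemma mod63_mod21: "(i :: int) mod 63 = j mod 63 \<Longrightarrow> i mod 21 = j mod 21"
  using mod_mod_cancel[of 21 63 i] mod_mod_cancel[of 21 63 j] by simp

lemma mod63_mod3: "(i :: int) mod 63 = j mod 63 \<Longrightarrow> i mod 3 = j mod 3"
  using mod_mod_cancel[of 3 63 i] mod_mod_cancel[of 3 63 j] by simp

lemma key_mod21: "(63 * a + (j - i) mod 63) mod 21 = 0 \<longleftrightarrow> j mod 21 = (i::int) mod 21"
proof -
  have "(63 * a + (j - i) mod 63) mod 21 = (j - i) mod 21"
    using mod_mod_cancel[of 21 63 "j - i"] mod_add_left_eq[of "63 * a" 21 "(j - i) mod 63"]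
    by simp
  hence "(63 * a + (j - i) mod 63) mod 21 = 0 \<longleftrightarrow> (j - i) mod 21 = 0"
    by (rule arg_cong)
  thus ?thesis
    by (simp only: mod_eq_dvd_iff mod_eq_0_iff_dvd)
qed

lemma keys: "distinct (map key flags)" "key ` set flags = {k \<in> {0..188}. k mod 21 \<noteq> 0}"
proof -
  have "distinct (sort (map key flags))"
    unfolding sort_keys by simp
  thus "distinct (map key flags)"
    by simp
  have "key ` set flags = set (sort (map key flags))"
    by simp
  thus "key ` set flags = {k \<in> {0..188}. k mod 21 \<noteq> 0}"
    unfolding sort_keys by auto
qed

lemma flag_nonspread: "(t, u, v) \<in> set flags \<Longrightarrow> v mod 21 \<noteq> u mod 21"
proof -
  assume "(t, u, v) \<in> set flags"
  hence "key (t, u, v) \<in> {k \<in> {0..188}. k mod 21 \<noteq> 0}"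
    unfolding keys(2)[symmetric] by blast
  hence "(63 * (u mod 3) + (v - u) mod 63) mod 21 \<noteq> 0"
    by (simp add: key_def)
  thus ?thesis
    by (simp only: key_mod21 simp_thms)
qed

text \<open>The two components of a key are quotient and remainder on division by 63.\<close>

lemma key_eq_iff:
  "key (t, u, v) = key (t', u', v') \<longleftrightarrow>
     u mod 3 = u' mod 3 \<and> (v - u) mod 63 = (v' - u') mod 63"
proof -
  have "63 * a + b = 63 * a' + b' \<longleftrightarrow> a = a' \<and> b = b'"
    if "0 \<le> b" "b < 63" "0 \<le> b'" "b' < 63" for a a' b b' :: int
  proof
    assume *: "63 * a + b = 63 * a' + b'"
    hence "(63 * a + b) div 63 = (63 * a' + b') div 63"
      by (rule arg_cong)
    hence "a = a'"
      using that by simp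
    thus "a = a' \<and> b = b'"
      using * by simp
  qed simp
  thus ?thesis
    by (simp add: key_def)
qed

text \<open>Reduction modulo 3 and taking differences both eliminate the shifts, so the keys agree
  and the flags coincide; comparing the first points then gives the shifts modulo 21.\<close>

lemma flag_unique:
  assumes "(t, u, v) \<in> set flags" "(t', u', v') \<in> set flags"
    and "pw (u + 3 * s) = pw (u' + 3 * s')" "pw (v + 3 * s) = pw (v' + 3 * s')"
  shows "t = t'" "s mod 21 = s' mod 21"
proof -
  have uv: "(u + 3 * s) mod 63 = (u' + 3 * s') mod 63" "(v + 3 * s) mod 63 = (v' + 3 * s') mod 63"
    using assms by (simp_all add: pw_eq_iff)
  have "u mod 3 = u' mod 3"
    using mod63_mod3[OF uv(1)] by simp
  moreover have "(v - u) mod 63 = (v' - u') mod 63"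
    using mod_diff_cong[OF uv(2,1)] by simp
  ultimately have "key (t, u, v) = key (t', u', v')"
    by (simp add: key_eq_iff)
  hence "(t, u, v) = (t', u', v')"
    using keys(1) assms by (auto simp: distinct_map inj_on_def)
  thus "t = t'" "s mod 21 = s' mod 21"
    using uv(1) by (simp_all add: mod63_triple)
qed

lemma flag_exists:
  assumes "j mod 21 \<noteq> i mod 21"
  obtains t u v s where "(t, u, v) \<in> set flags" "pw (u + 3 * s) = pw i" "pw (v + 3 * s) = pw j"
proof -
  have *: "(63 * (i mod 3) + (j - i) mod 63) mod 21 \<noteq> 0"
    using assms by (simp only: key_mod21) simp
  \<comment> \<open>The largest key is 63 * 2 + 62 = 188.\<close>
  have "63 * a + b \<in> {0..188}" if "0 \<le> a" "a < 3" "0 \<le> b" "b < 63" for a b :: int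
    using that by simp
  hence "63 * (i mod 3) + (j - i) mod 63 \<in> {0..188}"
    by simp
  \<comment> \<open>\<open>key\<close> ignores the triangle, so \<open>undefined\<close> stands in
    for the one still to be found.\<close>
  hence "key (undefined, i, j) \<in> {k \<in> {0..188}. k mod 21 \<noteq> 0}"
    using * by (simp only: key_def prod.case mem_Collect_eq simp_thms)
  hence "key (undefined, i, j) \<in> key ` set flags"
    by (simp only: keys(2))
  then obtain f where f: "key (undefined, i, j) = key f" "f \<in> set flags"
    by (rule imageE)
  obtain t u v where "f = (t, u, v)"
    by (cases f)
  hence flag: "(t, u, v) \<in> set flags" "key (t, u, v) = key (undefined, i, j)"
    using f by simp_all
  have uv: "u mod 3 = i mod 3" "(v - u) mod 63 = (j - i) mod 63"
    using flag(2) by (simp_all add: key_eq_iff)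
  \<comment> \<open>The division is exact because u and i agree modulo 3.\<close>
  define s where "s = (i - u) div 3"
  have s: "u + 3 * s = i"
    unfolding s_def using uv(1) by presburger
  have "((v - u) + i) mod 63 = ((j - i) + i) mod 63"
    using uv(2) by (rule mod_add_cong) (rule refl)
  moreover have "(v - u) + i = v + 3 * s"
    using s by simp
  ultimately have "pw (v + 3 * s) = pw j"
    by (simp only: pw_eq_iff diff_add_cancel)
  thus ?thesis
    by (intro that[OF flag(1)]) (simp_all only: s)
qed

text \<open>Two points of the common side L give a flag in each block, and both flags shift to the
  same ordered pair.\<close>

lemma block_unique:
  assumes "t \<in> set base" "t' \<in> set base" "L \<in> block t s" "L \<in> block t' s'"
  shows "t = t'" "s mod 21 = s' mod 21"
proof -
  obtain l l' where l: "l \<in> set (edges t)" "L = side s l" "l' \<in> set (edges t')" "L = side s' l'"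
    using assms by (auto simp: block_def)
  obtain u v where uv: "(u, v) \<in> set (pairs l)"
    by (cases l) auto
  note side = flag_side[OF assms(1) l(1) uv, of s]
  obtain u' v' where uv': "(u', v') \<in> set (pairs l')"
      "pw (u + 3 * s) = pw (u' + 3 * s')" "pw (v + 3 * s) = pw (v' + 3 * s')"
    using side_flag[OF assms(2) l(3), of "pw (u + 3 * s)" s' "pw (v + 3 * s)"] side(1-3) l
    by (metis pw_nonzero(1))
  have "(t, u, v) \<in> set flags" "(t', u', v') \<in> set flags"
    using assms l uv uv' by (auto simp: set_flags)
  thus "t = t'" "s mod 21 = s' mod 21"
    using flag_unique uv' by blast+
qed

lemma block_cong:
  assumes "s mod 21 = s' mod 21"
  shows "block t s = block t s'"
proof -
  have "pw (u + 3 * s) = pw (u + 3 * s')" for u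
    using assms by (simp add: pw_eq_iff mod63_triple)
  thus ?thesis
    by (simp add: block_def side_def)
qed

text \<open>The third vertex is nonzero and differs from the three nonzero points of the side
  through the other two, so it lies outside their plane.\<close>

lemma triangle_block:
  assumes "t \<in> set base"
  shows "F2.triangle (GF 64) (block t s)"
proof -
  obtain a b c p q r where t: "t = (a, b, c, p, q, r)"
    by (cases t)
  let ?x = "\<lambda>i. pw (i + 3 * s)"
  have e: "(a, b, p) \<in> set (edges t)" "(b, c, q) \<in> set (edges t)" "(c, a, r) \<in> set (edges t)"
    by (simp_all add: t)
  have pts: "{a, b, c, p} \<subseteq> {0..<63}" "distinct [a, b, c, p]"
    using base_points[rule_format, OF assms] by (simp_all add: t)
  hence "?x c \<noteq> ?x p"
    by (simp add: pw_shift_eq_iff)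
  hence "?x c \<notin> plane (?x a) (?x b)"
    using side_eq[OF assms e(1), of s] edge_distinct[OF assms e(2), of "3 * s"]
      edge_distinct[OF assms e(3), of "3 * s"] by (auto simp: side_def)
  hence "F2.independent {?x a, ?x b, ?x c}"
    using edge_distinct[OF assms e(1)] by (intro independent_3) simp_all
  moreover have "block t s = {F2.span {?x a, ?x b}, F2.span {?x b, ?x c}, F2.span {?x c, ?x a}}"
    by (simp add: block_def t side_def span_eq_plane)
  ultimately show ?thesis
    unfolding F2.triangle_def
    using edge_distinct[OF assms e(1), of "3 * s"] edge_distinct[OF assms e(2), of "3 * s"]
      edge_distinct[OF assms e(3), of "3 * s"]
    by (intro bexI[of _ "?x a"] bexI[of _ "?x b"] bexI[of _ "?x c"]) auto
qed

lemma gd_triangle_design_blocks: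
  "F2.gd_triangle_design 6 2 (GF 64) desarguesian_spread blocks"
  unfolding F2.gd_triangle_design_def
proof (intro conjI ballI allI impI)
  show "F2.has_dim (GF 64) 6"
    using card_GF[of 6] add_in_GF[of _ 6] zero_in_GF[of 64]
    by (simp add: F2_has_dim_iff F2_subspace_iff)
  show "H \<subseteq> GF 64" "F2.has_dim H 2" if "H \<in> desarguesian_spread" for H
    using that spread_has_dim_2 by (auto simp: spread_iff)
  show unique: "\<exists>!H. H \<in> desarguesian_spread \<and> x \<in> H" if "x \<in> GF 64" "x \<noteq> 0" for x
    using that GF4_line_in_spread[of x] GF4_line_refl[of x] spread_eq_GF4_line[of _ x] by blast
  show "F2.triangle (GF 64) T" if "T \<in> blocks" for T
    using that triangle_block by (auto simp: blocks_def)
  fix L assume L: "L \<subseteq> GF 64 \<and> F2.has_dim L 2"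
  then obtain x y where xy: "x \<in> L" "y \<in> L" "x \<noteq> 0" "y \<noteq> 0" "x \<noteq> y" "L = plane x y"
    using has_dim_2_obtain by metis
  obtain i j where ij: "x = pw i" "y = pw j"
    using L xy GF64_cases by (metis subsetD)
  have mod: "j mod 21 = i mod 21" if "H \<in> desarguesian_spread" "L \<subseteq> H" for H
    using spread_pw_iff[of H i j] that xy ij by auto
  show "(\<exists>!T. T \<in> blocks \<and> L \<in> T) \<and> \<not> (\<exists>H\<in>desarguesian_spread. L \<subseteq> H) \<or>
    \<not> (\<exists>T\<in>blocks. L \<in> T) \<and> (\<exists>!H. H \<in> desarguesian_spread \<and> L \<subseteq> H)"
  \<comment> \<open>Agreement modulo 21 means that x and y span a spread element; this selects the
    alternative that L satisfies.\<close>
  proof (cases "j mod 21 = i mod 21")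
    case True
    have "L \<notin> block t s" if t: "t \<in> set base" for t s
    proof
      assume "L \<in> block t s"
      then obtain l where l: "l \<in> set (edges t)" "L = side s l"
        by (auto simp: block_def)
      obtain u v where uv: "(u, v) \<in> set (pairs l)" "x = pw (u + 3 * s)" "y = pw (v + 3 * s)"
        using side_flag[OF t l(1), of x s y] l xy by metis
      hence "(t, u, v) \<in> set flags"
        using t l by (auto simp: set_flags)
      hence "v mod 21 \<noteq> u mod 21"
        by (rule flag_nonspread)
      moreover have "i mod 63 = (u + 3 * s) mod 63" "j mod 63 = (v + 3 * s) mod 63"
        using uv ij by (simp_all add: pw_eq_iff)
      \<comment> \<open>Translation preserves exponent differences, so the translate of a side
        outside the spread stays outside it.\<close>
      hence "(j - i) mod 63 = (v - u) mod 63"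
        using mod_diff_cong[of j 63 "v + 3 * s" i "u + 3 * s"] by simp
      hence "(j - i) mod 21 = (v - u) mod 21"
        by (rule mod63_mod21)
      moreover have "(j - i) mod 21 = 0"
        using True by (simp add: mod_eq_dvd_iff mod_eq_0_iff_dvd)
      ultimately show False
        by (metis mod_eq_dvd_iff mod_eq_0_iff_dvd)
    qed
    hence "\<not> (\<exists>T\<in>blocks. L \<in> T)"
      by (auto simp: blocks_def)
    moreover have "y \<in> GF4_line x"
      using True ij by (simp add: pw_in_GF4_line_iff)
    \<comment> \<open>This line is two-dimensional over \<open>GF(2)\<close> and shares the distinct
      nonzero points x and y with L.\<close>
    hence "GF4_line x = L"
      using xy ij GF4_line_in_spread[of x] GF4_line_refl[of x] spread_has_dim_2
      by (metis has_dim_2_eq_plane pw_in_GF64)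
    hence "\<exists>!H. H \<in> desarguesian_spread \<and> L \<subseteq> H"
      using unique[of x] xy ij GF4_line_in_spread[of x] by (metis pw_in_GF64 subsetD subset_refl)
    ultimately show ?thesis
      by blast
  next
    case False
    obtain t u v s where flag: "(t, u, v) \<in> set flags" "pw (u + 3 * s) = x" "pw (v + 3 * s) = y"
      using flag_exists[OF False] ij by metis
    then obtain l where l: "t \<in> set base" "l \<in> set (edges t)" "(u, v) \<in> set (pairs l)"
      by (auto simp: set_flags)
    have "L \<in> block t s"
      using flag_side(4)[OF l, of s] l flag xy by (auto simp: block_def)
    hence "\<exists>T. T \<in> blocks \<and> L \<in> T"
      using l by (auto simp: blocks_def)
    moreover have "T = T'" if T: "T \<in> blocks" "L \<in> T" "T' \<in> blocks" "L \<in> T'" for T T'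
    proof -
      obtain t s t' s' where *: "T = block t s" "T' = block t' s'" "t \<in> set base" "t' \<in> set base"
        using T by (auto simp: blocks_def)
      thus ?thesis
        using block_unique[of t t' L s s'] T block_cong by blast
    qed
    ultimately show ?thesis
      using False mod by blast
  qed
qed simp

section \<open>Balance\<close>

lemma covers_block_iff:
  assumes "t \<in> set base"
  shows "covers (block t s) (pw i) \<longleftrightarrow> (\<exists>p\<in>set (points t). i mod 63 = (p + 3 * s) mod 63)"
proof -
  obtain a b c p q r where t: "t = (a, b, c, p, q, r)"
    by (cases t)
  have e: "(a, b, p) \<in> set (edges t)" "(b, c, q) \<in> set (edges t)" "(c, a, r) \<in> set (edges t)"
    by (simp_all add: t)
  have "block t s = {side s (a, b, p), side s (b, c, q), side s (c, a, r)}"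
    by (simp add: block_def t)
  thus ?thesis
    unfolding covers_def
    by (auto simp: side_eq[OF assms e(1)] side_eq[OF assms e(2)] side_eq[OF assms e(3)] t pw_eq_iff)
qed

text \<open>A base point p can be moved to \<omega>^i by a power of \<omega>^3 iff p and i agree
  modulo 3, and then by exactly one. Covering blocks thus correspond to the base points in the
  residue class of i, of which there are 20.\<close>

lemma card_covering_blocks: "card {T \<in> blocks. covers T (pw i)} = 20"
proof -
  define P where "P = (SIGMA t:set base. {p \<in> set (points t). p mod 3 = i mod 3})"
  define f where "f = (\<lambda>(t, p). block t ((i - p) div 3))"
  have shift: "p + 3 * ((i - p) div 3) = i" if "p mod 3 = i mod 3" for p
    using that by presburger
  have "f ` P = {T \<in> blocks. covers T (pw i)}"
  proof (intro equalityI subsetI)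
    fix T assume "T \<in> f ` P"
    then obtain t p where tp: "t \<in> set base" "p \<in> set (points t)" "p mod 3 = i mod 3"
        "T = block t ((i - p) div 3)"
      by (auto simp: f_def P_def)
    hence "covers T (pw i)"
      using shift[of p] by (auto simp: covers_block_iff intro!: bexI[of _ p])
    thus "T \<in> {T \<in> blocks. covers T (pw i)}"
      using tp(1) unfolding blocks_def tp(4) by blast
  next
    fix T assume "T \<in> {T \<in> blocks. covers T (pw i)}"
    then obtain t s p where tp: "t \<in> set base" "T = block t s" "p \<in> set (points t)"
        "i mod 63 = (p + 3 * s) mod 63"
      unfolding blocks_def using covers_block_iff by blast
    have p: "p mod 3 = i mod 3"
      using mod63_mod3[OF tp(4)] by simp
    moreover have "(p + 3 * s) mod 63 = (p + 3 * ((i - p) div 3)) mod 63"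
      by (simp only: shift[OF p] tp(4))
    hence "s mod 21 = (i - p) div 3 mod 21"
      by (simp only: mod63_triple)
    hence "block t s = block t ((i - p) div 3)"
      by (rule block_cong)
    hence "T = f (t, p)"
      by (simp only: f_def prod.case tp(2))
    ultimately show "T \<in> f ` P"
      using tp(1,3) by (intro image_eqI[of _ _ "(t, p)"]) (simp_all add: P_def)
  qed
  moreover have "inj_on f P"
  proof (rule inj_onI, clarify)
    fix t p t' p' assume tp: "(t, p) \<in> P" "(t', p') \<in> P" and eq: "f (t, p) = f (t', p')"
    \<comment> \<open>Equal blocks share a side, and one common side is all that
      \<open>block_unique\<close> asks for.\<close>
    have "block t ((i - p) div 3) \<noteq> {}"
      by (cases t) (simp add: block_def)
    then obtain L where L: "L \<in> block t ((i - p) div 3)" "L \<in> block t' ((i - p') div 3)"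
      using eq by (auto simp: f_def)
    have "t \<in> set base" "t' \<in> set base"
      using tp by (simp_all add: P_def)
    from block_unique[OF this L] have "t = t'"
      and *: "(i - p) div 3 mod 21 = (i - p') div 3 mod 21" .
    have p: "p mod 3 = i mod 3" "p' mod 3 = i mod 3" "p \<in> {0..<63}" "p' \<in> {0..<63}"
      using tp base_points by (auto simp: P_def)
    \<comment> \<open>The shifts agree only modulo 21, which still gives the same translate of p. So
      one translation takes both p and p' to \<omega>^i.\<close>
    have "pw (p + 3 * ((i - p') div 3)) = pw (p + 3 * ((i - p) div 3))"
      by (simp only: pw_eq_iff mod63_triple *)
    also have "\<dots> = pw (p' + 3 * ((i - p') div 3))"
      by (simp only: shift[OF p(1)] shift[OF p(2)])
    finally have "p = p'"
      by (simp only: pw_shift_eq_iff[OF p(3,4)])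
    thus "t = t' \<and> p = p'"
      using \<open>t = t'\<close> by simp
  qed
  ultimately have "card {T \<in> blocks. covers T (pw i)} = card P"
    using card_image by metis
  also have "\<dots> = (\<Sum>t\<in>set base. length (filter (\<lambda>p. p mod 3 = i mod 3) (points t)))"
    unfolding P_def
  proof (subst card_SigmaI, goal_cases)
    case 3
    show ?case
    proof (rule sum.cong)
      fix t assume "t \<in> set base"
      hence "distinct (filter (\<lambda>p. p mod 3 = i mod 3) (points t))"
        using base_points by auto
      from distinct_card[OF this]
      show "card {p \<in> set (points t). p mod 3 = i mod 3} =
          length (filter (\<lambda>p. p mod 3 = i mod 3) (points t))"
        by simp
    qed simp
  qed auto
  also have "\<dots> = (\<Sum>t\<leftarrow>base. length (filter (\<lambda>p. p mod 3 = i mod 3) (points t)))"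
    using distinct_base by (rule sum.distinct_set_conv_list)
  also have "i mod 3 \<in> set [0..2]"
    using pos_mod_bound[of 3 i] by simp
  hence "(\<Sum>t\<leftarrow>base. length (filter (\<lambda>p. p mod 3 = i mod 3) (points t))) = 20"
    using count_points by blast
  finally show ?thesis .
qed

theorem theorem4:
  shows "card desarguesian_spread = 21 \<and>
    (\<exists>\<B>. F2.gd_triangle_design 6 2 (GF 64) desarguesian_spread \<B> \<and>
      balanced (GF 64) \<B>)"
proof -
  have "balanced (GF 64) blocks"
    unfolding balanced_def using card_covering_blocks by (metis GF64_cases)
  thus ?thesis
    using card_spread gd_triangle_design_blocks by blast
qed

end
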